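(* Let $G$ be a connected graph of order $n\ge 3$ that is not a star graph. Then $$\alpha(G)\le \gamma_{t,coi}(G)\le 2\alpha(G)-1.$$
   Context: All graphs are finite, simple and undirected. A star graph is a graph $K_{1,k}$ with $k\ge 1$. A vertex cover of $G$ is a set of vertices such that every edge of $G$ is incident with at least one vertex of the set; $\alpha(G)$ denotes the vertex cover number, the minimum cardinality of a vertex cover of $G$. A set $D\subseteq V(G)$ is a total dominating set of $G$ if every vertex of $V(G)$ is adjacent to at least one vertex of $D$. A total dominating set $D$ is a total co-independent dominating set (TC-ID set) if $V(G)\setminus D$ is nonempty and independent. The total co-independent domination number $\gamma_{t,coi}(G)$ is the minimum cardinality of a TC-ID set of $G$. *)

theory Defs
  imports "Graph_Theory.Graph_Theory" "Graph_Theory.Kuratowski"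
begin

text \<open>
  A finite simple undirected graph is an instance of the locale \<^locale>\<open>graph\<close> of the AFP entry
  Graph Theory: a finite digraph without loops and parallel arcs whose arc relation is symmetric.
  An undirected edge between \<open>u\<close> and \<open>v\<close> is the pair of opposite arcs between them, so adjacency
  is the relation \<open>dominates\<close>, written \<open>u \<rightarrow>\<^bsub>G\<^esub> v\<close>; that library name means only
  that there is an arc from \<open>u\<close> to \<open>v\<close> and is unrelated to dominating sets.
\<close>

definition star_graph :: "('a, 'b) pre_digraph \<Rightarrow> bool" where
  "star_graph G \<longleftrightarrow> (\<exists>k\<ge>1. K\<^bsub>1,k\<^esub> G)"

definition vertex_cover :: "('a, 'b) pre_digraph \<Rightarrow> 'a set \<Rightarrow> bool" where
  "vertex_cover G S \<longleftrightarrow> S \<subseteq> verts G \<and> (\<forall>e\<in>arcs G. tail G e \<in> S \<or> head G e \<in> S)"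

definition vertex_cover_number :: "('a, 'b) pre_digraph \<Rightarrow> nat" where
  "vertex_cover_number G = (LEAST k. \<exists>S. vertex_cover G S \<and> card S = k)"

definition independent_set :: "('a, 'b) pre_digraph \<Rightarrow> 'a set \<Rightarrow> bool" where
  "independent_set G I \<longleftrightarrow> I \<subseteq> verts G \<and> (\<forall>u\<in>I. \<forall>v\<in>I. \<not> u \<rightarrow>\<^bsub>G\<^esub> v)"

definition total_dominating_set :: "('a, 'b) pre_digraph \<Rightarrow> 'a set \<Rightarrow> bool" where
  "total_dominating_set G D \<longleftrightarrow> D \<subseteq> verts G \<and> (\<forall>v\<in>verts G. \<exists>u\<in>D. v \<rightarrow>\<^bsub>G\<^esub> u)"

text \<open>Total co-independent dominating set.\<close>

definition TC_ID_set :: "('a, 'b) pre_digraph \<Rightarrow> 'a set \<Rightarrow> bool" where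
  "TC_ID_set G D \<longleftrightarrow>
     total_dominating_set G D \<and> verts G - D \<noteq> {} \<and> independent_set G (verts G - D)"

text \<open>
  The value is unspecified if \<open>G\<close> has no TC-ID set; connected graphs of order at least 3 do have one.
\<close>

definition TC_ID_number :: "('a, 'b) pre_digraph \<Rightarrow> nat" where
  "TC_ID_number G = (LEAST k. \<exists>D. TC_ID_set G D \<and> card D = k)"

end

theory Submission
  imports Defs
begin

text \<open>
  The complement of a TC-ID set is independent, so every TC-ID set is a vertex cover; this is the
  lower bound. For the upper bound, let \<open>S\<close> be a minimum vertex cover; since \<open>G\<close> is not a star,
  \<open>|S| \<ge> 2\<close>. Vertices outside \<open>S\<close> have all their neighbours in \<open>S\<close>, so \<open>S\<close> becomes total dominating
  once every vertex that is isolated in the subgraph induced by \<open>S\<close> receives a neighbour \<open>f s\<close>. At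
  most \<open>|S| - 1\<close> vertices have to be added: either some vertex of \<open>S\<close> has a neighbour in \<open>S\<close>, or \<open>S\<close>
  is independent and, by connectedness, two vertices of \<open>S\<close> share a neighbour, which can be used
  for both. If the enlarged set is all of \<open>V(G)\<close>, then \<open>|V(G)| \<le> 2|S| - 1\<close>, and we take instead
  \<open>V(G) - {v}\<close> for a vertex \<open>v\<close> that is not the only neighbour of any vertex.
\<close>

section \<open>Vertex covers, TC-ID sets and the lower bound\<close>

lemma vertex_cover_adj:
  assumes "vertex_cover G S" "u \<rightarrow>\<^bsub>G\<^esub> v"
  shows "u \<in> S \<or> v \<in> S"
  using assms by (auto simp: vertex_cover_def arcs_ends_conv)

lemma TC_ID_set_imp_vertex_cover:
  assumes "wf_digraph G" "TC_ID_set G D"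
  shows "vertex_cover G D"
proof -
  interpret wf_digraph G by fact
  show ?thesis
    using assms(2)
    by (force simp: TC_ID_set_def total_dominating_set_def independent_set_def vertex_cover_def
        arcs_ends_conv)
qed

lemma ex_minimum_vertex_cover:
  assumes "wf_digraph G"
  obtains S where "vertex_cover G S" "card S = vertex_cover_number G"
proof -
  interpret wf_digraph G by fact
  have "vertex_cover G (verts G)"
    by (simp add: vertex_cover_def)
  then have "\<exists>k S. vertex_cover G S \<and> card S = k"
    by blast
  from LeastI_ex[OF this] show thesis
    using that by (auto simp: vertex_cover_number_def)
qed

lemma vertex_cover_number_le: "vertex_cover G S \<Longrightarrow> vertex_cover_number G \<le> card S"
  unfolding vertex_cover_number_def by (rule Least_le) blast

lemma TC_ID_number_le: "TC_ID_set G D \<Longrightarrow> TC_ID_number G \<le> card D"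
  unfolding TC_ID_number_def by (rule Least_le) blast

text \<open>The given set \<open>D\<close> ensures that the minimum in \<open>TC_ID_number\<close>
  is attained; the set attaining it is itself a vertex cover.\<close>

lemma vertex_cover_number_le_TC_ID_number:
  assumes "wf_digraph G" "TC_ID_set G D"
  shows "vertex_cover_number G \<le> TC_ID_number G"
proof -
  have "\<exists>k D. TC_ID_set G D \<and> card D = k"
    using assms(2) by blast
  from LeastI_ex[OF this] obtain D' where "TC_ID_set G D'" "card D' = TC_ID_number G"
    by (auto simp: TC_ID_number_def)
  then show ?thesis
    using TC_ID_set_imp_vertex_cover[OF assms(1)] vertex_cover_number_le by metis
qed

section \<open>Connected graphs and the upper bound\<close>

context graph
begin

lemma adj_sym: "u \<rightarrow>\<^bsub>G\<^esub> v \<Longrightarrow> v \<rightarrow>\<^bsub>G\<^esub> u"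
  using arcs_ends_symmetric[OF sym_arcs] by blast

lemma adj_irrefl: "\<not> u \<rightarrow>\<^bsub>G\<^esub> u"
  using no_loops by (auto simp: arcs_ends_conv)

text \<open>Induction along a walk from \<open>x\<close>. Used below to show that a small,
  explicitly given set already exhausts the graph.\<close>

lemma connected_closed_eq_verts:
  assumes "connected G" "X \<subseteq> verts G" "x \<in> X"
    and closed: "\<And>u v. u \<in> X \<Longrightarrow> u \<rightarrow>\<^bsub>G\<^esub> v \<Longrightarrow> v \<in> X"
  shows "X = verts G"
proof -
  have "v \<in> X" if "v \<in> verts G" for v
  proof -
    have "x \<rightarrow>\<^sup>*\<^bsub>G\<^esub> v"
      using symmetric_connected_imp_strongly_connected[OF sym_arcs assms(1)] assms(2,3) that
      by (auto simp: strongly_connected_def)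
    then show "v \<in> X"
      by (induction rule: reachable_induct) (use assms(3) closed in auto)
  qed
  then show ?thesis
    using assms(2) by blast
qed

lemma connected_ex_adj:
  assumes "connected G" "card (verts G) \<ge> 2" "v \<in> verts G"
  shows "\<exists>u. v \<rightarrow>\<^bsub>G\<^esub> u"
proof (rule ccontr)
  assume "\<nexists>u. v \<rightarrow>\<^bsub>G\<^esub> u"
  then have "{v} = verts G"
    using assms by (intro connected_closed_eq_verts[of _ v]) auto
  then have "card (verts G) = card {v}"
    by simp
  then show False
    using assms(2) by simp
qed

lemma independent_singleton: "v \<in> verts G \<Longrightarrow> independent_set G {v}"
  by (auto simp: independent_set_def adj_irrefl)

lemma vertex_cover_compl_independent:
  "vertex_cover G S \<Longrightarrow> S \<subseteq> D \<Longrightarrow> independent_set G (verts G - D)"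
  using vertex_cover_adj by (fastforce simp: independent_set_def)

text \<open>Otherwise every vertex is the only neighbour of some leaf. A leaf \<open>l\<close> at
  \<open>s\<close> then has a leaf \<open>m\<close> of its own, and the edge between
  \<open>s\<close> and \<open>l\<close> is a whole component, too small for three vertices.\<close>

lemma ex_not_unique_neighbour:
  assumes conn: "connected G" and card: "card (verts G) \<ge> 3"
  obtains v where "v \<in> verts G" "\<And>u. u \<in> verts G \<Longrightarrow> \<exists>w. u \<rightarrow>\<^bsub>G\<^esub> w \<and> w \<noteq> v"
proof (rule ccontr)
  assume "\<not> thesis"
  with that have "\<forall>v\<in>verts G. \<exists>u\<in>verts G. \<forall>w. u \<rightarrow>\<^bsub>G\<^esub> w \<longrightarrow> w = v"
    by blast
  then have *: "\<exists>u\<in>verts G. \<forall>w. u \<rightarrow>\<^bsub>G\<^esub> w \<longrightarrow> w = v" if "v \<in> verts G" for v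
    using that by blast
  have "card (verts G) \<ge> 2"
    using card by simp
  then have ex: "\<exists>w. u \<rightarrow>\<^bsub>G\<^esub> w" if "u \<in> verts G" for u
    using connected_ex_adj[OF conn _ that] by blast
  obtain s where s: "s \<in> verts G"
    using card by fastforce
  obtain l where l: "l \<in> verts G" "\<forall>w. l \<rightarrow>\<^bsub>G\<^esub> w \<longrightarrow> w = s"
    using *[OF s] by blast
  have ls: "l \<rightarrow>\<^bsub>G\<^esub> s"
    using ex l by blast
  obtain m where m: "m \<in> verts G" "\<forall>w. m \<rightarrow>\<^bsub>G\<^esub> w \<longrightarrow> w = l"
    using *[OF l(1)] by blast
  \<comment> \<open>The only possible neighbour of \<open>m\<close> is \<open>l\<close>, so
    \<open>m\<close> is in turn a neighbour of \<open>l\<close>, and \<open>s\<close> is the only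
    one.\<close>
  have "m = s"
    using ex[OF m(1)] m(2) l(2) adj_sym by blast
  then have "{s, l} = verts G"
    using l m s by (intro connected_closed_eq_verts[OF conn, of _ s]) auto
  then show False
    using card card_insert_le_m1[of 2 "{l}" s] by simp
qed

lemma ex_large_TC_ID_set:
  assumes "connected G" "card (verts G) \<ge> 3"
  obtains D where "TC_ID_set G D" "card D = card (verts G) - 1"
proof -
  obtain v where v: "v \<in> verts G" "\<And>u. u \<in> verts G \<Longrightarrow> \<exists>w. u \<rightarrow>\<^bsub>G\<^esub> w \<and> w \<noteq> v"
    using ex_not_unique_neighbour[OF assms] by blast
  have "verts G - (verts G - {v}) = {v}"
    using v(1) by blast
  moreover have "\<exists>w\<in>verts G - {v}. u \<rightarrow>\<^bsub>G\<^esub> w" if "u \<in> verts G" for u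
    using v(2)[OF that] adj_in_verts(2) by blast
  ultimately have "TC_ID_set G (verts G - {v})"
    using v(1) independent_singleton[OF v(1)]
    by (simp add: TC_ID_set_def total_dominating_set_def)
  then show thesis
    using that v(1) by (simp add: card_Diff_singleton)
qed

text \<open>Without a shared neighbour, a walk leaving some \<open>s\<close> in \<open>S\<close> can
  only return to \<open>s\<close>, so \<open>s\<close> and its neighbours are the whole graph and
  leave no room for a second vertex of \<open>S\<close>.\<close>

lemma independent_vertex_cover_common_neighbour:
  assumes conn: "connected G" and cover: "vertex_cover G S" and card: "card S \<ge> 2"
    and indep: "\<And>u v. u \<in> S \<Longrightarrow> v \<in> S \<Longrightarrow> \<not> u \<rightarrow>\<^bsub>G\<^esub> v"
  obtains a b w where "a \<in> S" "b \<in> S" "a \<noteq> b" "a \<rightarrow>\<^bsub>G\<^esub> w" "b \<rightarrow>\<^bsub>G\<^esub> w"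
proof (rule ccontr)
  assume "\<not> thesis"
  with that have no: "\<forall>a\<in>S. \<forall>b\<in>S. \<forall>w. a \<rightarrow>\<^bsub>G\<^esub> w \<longrightarrow> b \<rightarrow>\<^bsub>G\<^esub> w \<longrightarrow> a = b"
    by blast
  have sub: "S \<subseteq> verts G"
    using cover by (simp add: vertex_cover_def)
  obtain s where s: "s \<in> S"
    using card by fastforce
  have "insert s {w. s \<rightarrow>\<^bsub>G\<^esub> w} = verts G"
  proof (rule connected_closed_eq_verts[OF conn])
    fix u v assume "u \<in> insert s {w. s \<rightarrow>\<^bsub>G\<^esub> w}" "u \<rightarrow>\<^bsub>G\<^esub> v"
    \<comment> \<open>Independence puts \<open>u\<close> outside \<open>S\<close>, so the cover
      contains \<open>v\<close>; now \<open>u\<close> is a common neighbour of \<open>s\<close> and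
      \<open>v\<close>.\<close>
    moreover have "v = s" if "s \<rightarrow>\<^bsub>G\<^esub> u"
      using no that indep s vertex_cover_adj[OF cover \<open>u \<rightarrow>\<^bsub>G\<^esub> v\<close>] adj_sym[OF \<open>u \<rightarrow>\<^bsub>G\<^esub> v\<close>]
      by blast
    ultimately show "v \<in> insert s {w. s \<rightarrow>\<^bsub>G\<^esub> w}"
      by blast
  qed (use s sub in auto)
  then have "S \<subseteq> {s}"
    using sub indep s by blast
  then show False
    using card card_mono[of "{s}" S] by simp
qed

text \<open>Choose a neighbour \<open>f x\<close> for each \<open>x\<close> in \<open>S\<close> so
  that the value at one vertex \<open>s\<close> is redundant: it lies in \<open>S\<close> or is also
  the value at another vertex. Then \<open>T\<close> is the image of \<open>S - {s}\<close>.\<close>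

lemma ex_small_dominating_complement:
  assumes conn: "connected G" and n: "card (verts G) \<ge> 2"
    and cover: "vertex_cover G S" and card: "card S \<ge> 2"
  obtains T where "T \<subseteq> verts G" "card T \<le> card S - 1" "\<And>s. s \<in> S \<Longrightarrow> \<exists>t\<in>S \<union> T. s \<rightarrow>\<^bsub>G\<^esub> t"
proof -
  have sub: "S \<subseteq> verts G"
    using cover by (simp add: vertex_cover_def)
  then have fin: "finite S"
    by (rule finite_subset) simp
  have "\<exists>g. \<forall>s\<in>S. s \<rightarrow>\<^bsub>G\<^esub> g s"
    using connected_ex_adj[OF conn n] sub by (intro bchoice) blast
  then obtain g where g: "\<And>s. s \<in> S \<Longrightarrow> s \<rightarrow>\<^bsub>G\<^esub> g s"
    by blast
  have "\<exists>f s. (\<forall>s\<in>S. s \<rightarrow>\<^bsub>G\<^esub> f s) \<and> s \<in> S \<and> (\<forall>x\<in>S. f x \<in> S \<union> f ` (S - {s}))"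
  proof (cases "\<exists>u\<in>S. \<exists>v\<in>S. u \<rightarrow>\<^bsub>G\<^esub> v")
    case True
    then obtain u v where "u \<in> S" "v \<in> S" "u \<rightarrow>\<^bsub>G\<^esub> v"
      by blast
    \<comment> \<open>The value at \<open>u\<close> is redirected to \<open>v\<close>, which is
      already in \<open>S\<close>.\<close>
    then show ?thesis
      using g by (intro exI[of _ "g(u := v)"] exI[of _ u]) auto
  next
    case False
    then obtain a b w where "a \<in> S" "b \<in> S" "a \<noteq> b" "a \<rightarrow>\<^bsub>G\<^esub> w" "b \<rightarrow>\<^bsub>G\<^esub> w"
      using independent_vertex_cover_common_neighbour[OF conn cover card] by blast
    \<comment> \<open>The value at \<open>a\<close> may be dropped because \<open>b\<close> supplies
      the same \<open>w\<close>.\<close>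
    then show ?thesis
      using g by (intro exI[of _ "g(a := w, b := w)"] exI[of _ a]) auto
  qed
  then obtain f s where f: "\<And>x. x \<in> S \<Longrightarrow> x \<rightarrow>\<^bsub>G\<^esub> f x" and "s \<in> S"
    and cov: "\<And>x. x \<in> S \<Longrightarrow> f x \<in> S \<union> f ` (S - {s})"
    by blast
  show thesis
  proof (rule that[of "f ` (S - {s})"])
    show "f ` (S - {s}) \<subseteq> verts G"
      using f adj_in_verts(2) by blast
    show "card (f ` (S - {s})) \<le> card S - 1"
      using card_image_le[of "S - {s}" f] fin \<open>s \<in> S\<close> by simp
  qed (use f cov in blast)
qed

lemma star_graph_if_vertex_cover_card_le_1:
  assumes conn: "connected G" and n: "card (verts G) \<ge> 2"
    and cover: "vertex_cover G S" and card: "card S \<le> 1"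
  shows "star_graph G"
proof -
  have sub: "S \<subseteq> verts G"
    using cover by (simp add: vertex_cover_def)
  then have fin: "finite S"
    by (rule finite_subset) simp
  obtain x where "x \<in> verts G"
    using n by fastforce
  \<comment> \<open>An edge exists, so the empty set is not a cover.\<close>
  then have "S \<noteq> {}"
    using connected_ex_adj[OF conn n] vertex_cover_adj[OF cover] by blast
  with card fin have "card S = 1"
    by (metis card_0_eq le_antisym less_one not_le)
  then obtain c where S: "S = {c}"
    using card_1_singletonE by blast
  have c: "c \<in> verts G"
    using S sub by blast
  have *: "u = c \<or> v = c" if "u \<rightarrow>\<^bsub>G\<^esub> v" for u v
    using vertex_cover_adj[OF cover that] S by blast
  have adj: "c \<rightarrow>\<^bsub>G\<^esub> v \<and> v \<rightarrow>\<^bsub>G\<^esub> c" if "v \<in> verts G" "v \<noteq> c" for v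
    using connected_ex_adj[OF conn n that(1)] * that(2) adj_sym by metis
  let ?L = "verts G - {c}"
  \<comment> \<open>Each undirected edge of the star contributes both orientations.\<close>
  have "arcs_ends G = {c} \<times> ?L \<union> ?L \<times> {c}"
    using * adj adj_irrefl by (auto dest: adj_in_verts)
  moreover have "verts G = {c} \<union> ?L" "{c} \<inter> ?L = {}" "card {c} = 1"
    using c by auto
  ultimately have "K\<^bsub>1,card ?L\<^esub> G"
    unfolding complete_bipartite_digraph_def using graph_axioms by blast
  moreover have "card ?L \<ge> 1"
    using n c by simp
  ultimately show ?thesis
    by (auto simp: star_graph_def)
qed

lemma ex_small_TC_ID_set:
  assumes conn: "connected G" and n: "card (verts G) \<ge> 3"
    and cover: "vertex_cover G S" and card: "card S \<ge> 2"
  obtains D where "TC_ID_set G D" "card D \<le> 2 * card S - 1"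
proof -
  have n2: "card (verts G) \<ge> 2"
    using n by simp
  obtain T where T: "T \<subseteq> verts G" "card T \<le> card S - 1" "\<And>s. s \<in> S \<Longrightarrow> \<exists>t\<in>S \<union> T. s \<rightarrow>\<^bsub>G\<^esub> t"
    using ex_small_dominating_complement[OF conn n2 cover card] by blast
  let ?D = "S \<union> T"
  have D: "?D \<subseteq> verts G"
    using T(1) cover by (simp add: vertex_cover_def)
  have card_D: "card ?D \<le> 2 * card S - 1"
    using card_Un_le[of S T] T(2) card by linarith
  show thesis
  proof (cases "?D = verts G")
    case True
    obtain D' where "TC_ID_set G D'" "card D' = card (verts G) - 1"
      using ex_large_TC_ID_set[OF conn n] by blast
    then show thesis
      using that[of D'] card_D True by simp
  next
    case False
    have "\<exists>u\<in>?D. v \<rightarrow>\<^bsub>G\<^esub> u" if "v \<in> verts G" for v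
    proof (cases "v \<in> S")
      case False
      then show ?thesis
        using connected_ex_adj[OF conn n2 that] vertex_cover_adj[OF cover] by blast
    qed (rule T(3))
    then have "TC_ID_set G ?D"
      using D False vertex_cover_compl_independent[OF cover, of ?D]
      by (auto simp: TC_ID_set_def total_dominating_set_def)
    then show thesis
      using that card_D by blast
  qed
qed

end

theorem theorem8:
  fixes G :: "('a, 'b) pre_digraph"
  assumes "graph G"
    and "connected G"
    and "card (verts G) \<ge> 3"
    and "\<not> star_graph G"
  shows "vertex_cover_number G \<le> TC_ID_number G \<and>
         int (TC_ID_number G) \<le> 2 * int (vertex_cover_number G) - 1"
proof -
  interpret graph G by fact
  obtain S where S: "vertex_cover G S" "card S = vertex_cover_number G"
    using ex_minimum_vertex_cover[OF wf_digraph] by blast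
  have card: "card S \<ge> 2"
    using star_graph_if_vertex_cover_card_le_1[OF assms(2) _ S(1)] assms(3,4) by linarith
  obtain D where D: "TC_ID_set G D" "card D \<le> 2 * card S - 1"
    using ex_small_TC_ID_set[OF assms(2,3) S(1) card] by blast
  have "TC_ID_number G \<le> 2 * card S - 1"
    using TC_ID_number_le[OF D(1)] D(2) by linarith
  \<comment> \<open>By \<open>card\<close>, the truncated subtraction on naturals agrees with
    integer subtraction.\<close>
  then have "int (TC_ID_number G) \<le> 2 * int (vertex_cover_number G) - 1"
    using S(2) card by linarith
  then show ?thesis
    using vertex_cover_number_le_TC_ID_number[OF wf_digraph D(1)] by blast
qed

end
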